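(* Let $F$ be a field and let $m = 2m'$, $n = 2n'$ be arbitrary positive even integers (with $m', n'$ positive integers). Let $X = \{x_1, x_2, \dots\}$ be a countably infinite set and let $F\langle X\rangle$ be the free unital associative $F$-algebra freely generated by $X$. Then $$T^{(m)} T^{(n)} \nsubseteq T^{(m+n-1)},$$ where, for $\ell \ge 2$, $T^{(\ell)}$ denotes the two-sided ideal of $F\langle X\rangle$ generated by all left-normed commutators $[a_1, a_2, \dots, a_\ell]$ with $a_i \in F\langle X\rangle$.
   Context: Left-normed commutators in an associative algebra are defined recursively by $[a_1,a_2] = a_1a_2 - a_2a_1$ and $[a_1,\dots,a_{\ell-1},a_\ell] = [[a_1,\dots,a_{\ell-1}],a_\ell]$ for $\ell \ge 3$. The product $T^{(m)}T^{(n)}$ is the usual product of two-sided ideals. The field $F$ has arbitrary characteristic. *)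

theory Defs
  imports
    "HOL-Library.Poly_Mapping"
    "HOL-Algebra.Ideal_Product"
    "HOL-Algebra.Algebraic_Closure_Type"
begin

text \<open>
  The free monoid is written additively because multiplication of type
  \<^typ>\<open>'k \<Rightarrow>\<^sub>0 'a\<close> is convolution with respect to a \<^class>\<open>monoid_add\<close> structure on
  the keys.  The sum of two words is therefore their (noncommutative) concatenation.
\<close>

datatype 'a free_monoid = Word (letters: "'a list")

instantiation free_monoid :: (type) monoid_add
begin

definition zero_free_monoid :: "'a free_monoid"
  where "0 = Word []"

definition plus_free_monoid :: "'a free_monoid \<Rightarrow> 'a free_monoid \<Rightarrow> 'a free_monoid"
  where "u + v = Word (letters u @ letters v)"

instance
  by standard (simp_all add: zero_free_monoid_def plus_free_monoid_def)

end

text \<open>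
  \<open>('x, 'a) free_algebra\<close> is the monoid algebra of the free monoid on \<open>'x\<close> over \<open>'a\<close>,
  i.e. the free unital associative algebra on \<open>'x\<close>: finitely supported functions from
  words to coefficients.
\<close>

type_synonym ('x, 'a) free_algebra = "'x free_monoid \<Rightarrow>\<^sub>0 'a"

text \<open>
  The library proves that \<^const>\<open>ring_of_type_algebra\<close> is a ring only for commutative
  rings; here it is needed for noncommutative ones.
\<close>

lemma ring_ring_of_type_algebra:
  "ring (ring_of_type_algebra :: 'b :: ring_1 ring)"
proof -
  have "\<exists>y. y + x = 0 \<and> x + y = 0" for x :: 'b
    by (rule exI[of _ "- x"]) simp
  then show ?thesis
    unfolding ring_of_type_algebra_def
    by unfold_locales (auto simp: algebra_simps Units_def)
qed

definition commutator :: "'b :: ring_1 \<Rightarrow> 'b \<Rightarrow> 'b"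
  where "commutator a b = a * b - b * a"

text \<open>The list \<open>[a\<^sub>1, \<dots>, a\<^sub>l]\<close> is sent to \<open>[\<dots>[[a\<^sub>1, a\<^sub>2], a\<^sub>3], \<dots>, a\<^sub>l]\<close>.\<close>

definition left_normed_commutator :: "'b :: ring_1 list \<Rightarrow> 'b"
  where "left_normed_commutator xs = foldl commutator (hd xs) (tl xs)"

lemma left_normed_commutator_pair:
  "left_normed_commutator [a, b] = a * b - b * a"
  by (simp add: left_normed_commutator_def commutator_def)

lemma left_normed_commutator_snoc:
  assumes "length xs \<ge> 2"
  shows "left_normed_commutator (xs @ [b]) = commutator (left_normed_commutator xs) b"
  using assms by (cases xs) (simp_all add: left_normed_commutator_def)

text \<open>
  \<open>T_ideal l\<close> is \<open>T\<^sup>(\<^sup>l\<^sup>)\<close>; it is meant for \<open>l \<ge> 2\<close>.  The library's \<^locale>\<open>ideal\<close> is two-sided,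
  so \<^const>\<open>genideal\<close> yields the generated two-sided ideal.
\<close>

definition T_ideal :: "nat \<Rightarrow> (nat, 'a :: field) free_algebra set"
  where "T_ideal l =
    Idl\<^bsub>ring_of_type_algebra\<^esub> {left_normed_commutator xs | xs. length xs = l}"

end

theory Submission
  imports Defs
begin

text \<open>
  The idea is to find an algebra in which every left-normed commutator of length \<open>m + n - 1\<close>
  vanishes while some product of commutators of lengths \<open>m\<close> and \<open>n\<close> does not.  In characteristic
  different from 2 the tensor product of two Grassmann algebras, the second one on \<open>m + n - 4\<close>
  generators, is such an algebra.  To cover all fields, the Grassmann generators are replaced by
  elements \<open>x\<^sub>i\<close> with \<open>[x\<^sub>i, x\<^sub>j] = e\<^sub>i e\<^sub>j\<close>, where the \<open>e\<^sub>i\<close> generate a Grassmann algebra and commute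
  with the \<open>x\<^sub>j\<close>; for words \<open>v\<close>, \<open>w\<close> in the \<open>x\<^sub>i\<close> this gives \<open>[v, w] = dv dw\<close> for the derivation \<open>d\<close>
  with \<open>d x\<^sub>i = e\<^sub>i\<close>, and \<open>dv dw\<close> is central.  Given a second such system \<open>y\<^sub>i\<close>, \<open>f\<^sub>i\<close> commuting with the first,
  put \<open>z\<^sub>i = x\<^sub>i y\<^sub>i\<close>.  In an iterated commutator of elements of the algebra generated by the \<open>z\<^sub>i\<close>, every
  second step produces a new factor \<open>dv dw\<close> of the second system, so that long commutators vanish
  once only \<open>m + n - 4\<close> of the \<open>f\<^sub>i\<close> are nonzero.  On the other hand, if \<open>y\<^sub>i = 1\<close> for the first and the
  last index, \<open>[z\<^sub>1, \<dots>, z\<^sub>m] = e\<^sub>1 \<cdots> e\<^sub>m f\<^sub>2 \<cdots> f\<^bsub>m-1\<^esub>\<close>.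
\<close>

section \<open>Algebras with Grassmann-valued commutators\<close>

text \<open>Brings a commutation rule into the shape that rewrites inside right-nested products, so
  that \<open>simp\<close> can sort factors.\<close>

lemma commute_left: "a * b = b * a \<Longrightarrow> a * (b * c) = b * (a * c)" for a b c :: "'r :: semigroup_mult"
  by (metis mult.assoc)

lemma commutes_prod_list:
  fixes a :: "'r :: monoid_mult"
  assumes "\<And>b. b \<in> set bs \<Longrightarrow> a * b = b * a"
  shows "a * prod_list bs = prod_list bs * a"
  using assms
proof (induction bs)
  case (Cons b bs)
  then show ?case
    by (simp add: mult.assoc commute_left[of a b])
qed simp

locale exterior_system =
  fixes x e :: "'i \<Rightarrow> 'r :: ring_1"
  assumes commutator_x: "x i * x j - x j * x i = e i * e j"
    and e_anticommute: "e i * e j = - (e j * e i)"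
    and e_square: "e i * e i = 0"
    and e_x: "e i * x j = x j * e i"
begin

definition word :: "'i list \<Rightarrow> 'r"
  where "word w = prod_list (map x w)"

lemma word_simps [simp]: "word [] = 1" "word (i # w) = x i * word w" "word (v @ w) = word v * word w"
  by (simp_all add: word_def)

text \<open>The derivation sending \<open>x i\<close> to \<open>e i\<close>, taken on words rather
  than on elements, so that no well-definedness has to be shown.\<close>

primrec diff :: "'i list \<Rightarrow> 'r"
  where
    "diff [] = 0"
  | "diff (i # w) = e i * word w + x i * diff w"

lemma commutes_word: "(\<And>i. a * x i = x i * a) \<Longrightarrow> a * word w = word w * a"
  unfolding word_def by (rule commutes_prod_list) auto

lemma x_word: "x i * word w - word w * x i = e i * diff w"
proof (induction w)
  case (Cons j w)
  have "x i * word (j # w) - word (j # w) * x i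
      = (x i * x j - x j * x i) * word w + x j * (x i * word w - word w * x i)"
    by (simp add: algebra_simps)
  also have "\<dots> = e i * e j * word w + (x j * e i) * diff w"
    by (simp only: commutator_x Cons.IH mult.assoc)
  finally show ?case
    by (simp add: algebra_simps flip: e_x)
qed simp

text \<open>Moving \<open>x i\<close> past \<open>e j * word w\<close> and past
  \<open>x j * diff w\<close> leaves the errors \<open>e j * e i * diff w\<close> and
  \<open>e i * e j * diff w\<close>, which cancel by anticommutativity.\<close>

lemma x_diff: "x i * diff w = diff w * x i"
proof (induction w)
  case (Cons j w)
  have "x i * diff (j # w) - diff (j # w) * x i
      = (x i * e j) * word w - e j * (word w * x i) + x i * x j * diff w - x j * (diff w * x i)"
    by (simp add: algebra_simps)
  also have "\<dots> = e j * (x i * word w - word w * x i) + (x i * x j - x j * x i) * diff w"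
    by (simp add: algebra_simps flip: Cons.IH e_x)
  also have "\<dots> = (e j * e i) * diff w + (e i * e j) * diff w"
    by (simp only: commutator_x x_word mult.assoc)
  also have "\<dots> = 0"
    by (subst (2) e_anticommute) simp
  finally show ?case
    by simp
qed simp

lemma word_diff: "word v * diff w = diff w * word v"
  using commutes_word[of "diff w" v] by (simp add: x_diff)

text \<open>Bracketing with a fixed \<open>word w\<close> is a derivation in \<open>word v\<close>;
  as \<open>diff w\<close> commutes with words, it collects on the right and \<open>diff v\<close>
  builds up in front of it.\<close>

lemma commutator_word: "word v * word w - word w * word v = diff v * diff w"
proof (induction v)
  case (Cons i v)
  have "word (i # v) * word w - word w * word (i # v)
      = x i * (word v * word w - word w * word v) + (x i * word w - word w * x i) * word v"
    by (simp add: algebra_simps)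
  also have "\<dots> = x i * (diff v * diff w) + e i * (diff w * word v)"
    by (simp only: Cons.IH x_word mult.assoc)
  finally show ?case
    by (simp add: algebra_simps flip: word_diff)
qed simp

lemma e_sandwich: "e i * (prod_list (map e w) * e i) = 0"
proof (induction w)
  case (Cons j w)
  have "e i * (prod_list (map e (j # w)) * e i) = (e i * e j) * (prod_list (map e w) * e i)"
    by (simp add: mult.assoc)
  also have "\<dots> = - (e j * (e i * (prod_list (map e w) * e i)))"
    by (subst e_anticommute) (simp add: mult.assoc)
  finally show ?case
    by (simp add: Cons.IH)
qed (simp add: e_square)

text \<open>Pigeonhole: either some letter lies outside \<open>A\<close>, or a letter repeats, and
  the part between the two occurrences is killed by \<open>e_sandwich\<close>.\<close>

lemma prod_e_eq_0:
  assumes A: "finite A" "\<And>i. i \<notin> A \<Longrightarrow> e i = 0" and len: "card A < length w"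
  shows "prod_list (map e w) = 0"
proof (cases "set w \<subseteq> A")
  case True
  then have "\<not> distinct w"
    using A(1) len by (metis card_mono distinct_card leD)
  then obtain u v s i where w: "w = u @ [i] @ v @ [i] @ s"
    using not_distinct_decomp by blast
  have "prod_list (map e w)
      = prod_list (map e u) * ((e i * (prod_list (map e v) * e i)) * prod_list (map e s))"
    by (simp add: w mult.assoc)
  then show ?thesis
    by (simp add: e_sandwich)
next
  case False
  then obtain i where "i \<in> set w" and e_i: "e i = 0"
    using A(2) by blast
  then obtain u v where "w = u @ i # v"
    by (meson split_list)
  then show ?thesis
    by (simp add: e_i)
qed

lemma commutes_diff:
  assumes "\<And>i. a * x i = x i * a" "\<And>i. a * e i = e i * a"
  shows "a * diff w = diff w * a"
proof (induction w)
  case (Cons i w)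
  have "a * diff (i # w) = e i * (a * word w) + x i * (a * diff w)"
    by (simp add: assms distrib_left flip: mult.assoc)
  then show ?case
    by (simp add: Cons.IH commutes_word assms distrib_right mult.assoc)
qed simp

lemma word_prod_diff: "word v * prod_list (map diff ws) = prod_list (map diff ws) * word v"
  by (rule commutes_prod_list) (auto simp: word_diff)

lemma x_prod_e: "x i * prod_list (map e w) = prod_list (map e w) * x i"
  by (rule commutes_prod_list) (auto simp: e_x)

text \<open>
  By induction on the number of factors, each \<open>diff w\<close> is traded for letters \<open>e\<close>, which can be moved
  to the front; too many of them must contain a repetition.
\<close>

lemma prod_diff_eq_0:
  assumes A: "finite A" "\<And>i. i \<notin> A \<Longrightarrow> e i = 0" and len: "card A < length ws"
  shows "prod_list (map diff ws) = 0"
proof -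
  have "prod_list (map e v) * prod_list (map diff ws) = 0"
    if "card A < length v + length ws" for v
    using that
  proof (induction ws arbitrary: v)
    case Nil
    then show ?case
      using prod_e_eq_0[OF A] by simp
  next
    case outer: (Cons w ws)
    let ?P = "prod_list (map diff ws)"
    \<comment> \<open>By the Leibniz rule, the term with \<open>e i\<close> lengthens
      \<open>v\<close> and falls under the outer hypothesis; in the other term \<open>x i\<close>
      moves out to the left and the inner hypothesis applies.\<close>
    have "prod_list (map e v) * (diff w * ?P) = 0"
    proof (induction w)
      case (Cons i w)
      have "prod_list (map e v) * (diff (i # w) * ?P)
          = prod_list (map e (v @ [i])) * (word w * ?P)
            + (prod_list (map e v) * x i) * (diff w * ?P)"
        by (simp add: algebra_simps)
      also have "\<dots> = (prod_list (map e (v @ [i])) * ?P) * word w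
            + x i * (prod_list (map e v) * (diff w * ?P))"
        by (simp only: word_prod_diff mult.assoc flip: x_prod_e)
      also have "\<dots> = 0"
        using outer.IH[of "v @ [i]"] outer.prems Cons.IH by simp
      finally show ?case .
    qed simp
    then show ?case
      by simp
  qed
  from this[of "[]"] len show ?thesis
    by simp
qed

end

section \<open>Commutators in a product of two systems\<close>

inductive_set add_span :: "'r :: ring_1 set \<Rightarrow> 'r set" for B
  where
    zero: "0 \<in> add_span B"
  | add: "b \<in> B \<Longrightarrow> s \<in> add_span B \<Longrightarrow> b + s \<in> add_span B"

lemma add_span_base: "b \<in> B \<Longrightarrow> b \<in> add_span B"
  using add_span.add[OF _ add_span.zero] by fastforce

lemma add_span_add: "s \<in> add_span B \<Longrightarrow> t \<in> add_span B \<Longrightarrow> s + t \<in> add_span B"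
  by (induction rule: add_span.induct) (auto simp: add.assoc intro: add_span.add)

lemma add_span_sum: "(\<And>a. a \<in> A \<Longrightarrow> f a \<in> add_span B) \<Longrightarrow> sum f A \<in> add_span B"
  by (induction A rule: infinite_finite_induct) (auto intro: add_span.zero add_span_add)

lemma add_span_mono: "s \<in> add_span B \<Longrightarrow> B \<subseteq> C \<Longrightarrow> s \<in> add_span C"
  by (induction rule: add_span.induct) (auto intro: add_span.intros)

lemma commutator_simps:
  "commutator 0 b = 0" "commutator b 0 = 0"
  "commutator (a + a') b = commutator a b + commutator a' b"
  "commutator a (b + b') = commutator a b + commutator a b'"
  by (simp_all add: commutator_def algebra_simps)

lemma commutator_add_span:
  assumes "\<And>b c. b \<in> B \<Longrightarrow> c \<in> C \<Longrightarrow> commutator b c \<in> add_span D"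
    and "s \<in> add_span B" "t \<in> add_span C"
  shows "commutator s t \<in> add_span D"
  using assms(2)
proof induction
  case zero
  then show ?case
    by (simp add: commutator_simps add_span.zero)
next
  case (add b s)
  have "commutator b t \<in> add_span D"
    using assms(3)
    by induction (auto simp: commutator_simps add.hyps intro!: add_span.zero add_span_add assms(1))
  with add show ?case
    by (simp add: commutator_simps add_span_add)
qed

locale exterior_pair = X: exterior_system x e + Y: exterior_system y f
  for x e y f :: "'i \<Rightarrow> 'r :: ring_1" +
  assumes x_y: "x i * y j = y j * x i"
    and x_f: "x i * f j = f j * x i"
    and e_y: "e i * y j = y j * e i"
    and e_f: "e i * f j = f j * e i"
begin

lemma X_word_y: "X.word w * y i = y i * X.word w" and X_word_f: "X.word w * f i = f i * X.word w"
  using X.commutes_word[of "y i" w] X.commutes_word[of "f i" w] by (auto simp: x_y x_f)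

lemma X_diff_y: "X.diff w * y i = y i * X.diff w" and X_diff_f: "X.diff w * f i = f i * X.diff w"
  using X.commutes_diff[of "y i" w] X.commutes_diff[of "f i" w] by (auto simp: x_y x_f e_y e_f)

text \<open>Such coefficients can pass everything met in a bracket with \<open>center_words\<close>:
  both kinds of words and the factors \<open>Y.diff\<close>.\<close>

definition centralizer :: "'r set"
  where "centralizer =
    {u. \<forall>i. u * x i = x i * u \<and> u * y i = y i * u \<and> u * f i = f i * u}"

text \<open>The number of factors from the second system, counted in pairs, is the degree that grows
  along iterated commutators.\<close>

definition Y_products :: "nat \<Rightarrow> 'r set"
  where "Y_products p = {prod_list (map Y.diff ws) | ws. length ws = 2 * p}"

text \<open>
  The summands of iterated commutators: in \<open>alpha p\<close> only the \<open>y\<close>-word, in \<open>beta p\<close> only the \<open>x\<close>-word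
  fails to commute with the generators, and each further bracket interchanges the two types.
\<close>

definition alpha :: "nat \<Rightarrow> 'r set"
  where "alpha p = {u * Y.word w * v | u w v. u \<in> centralizer \<and> v \<in> Y_products p}"

definition beta :: "nat \<Rightarrow> 'r set"
  where "beta p = {X.word w * u * v | u w v. u \<in> centralizer \<and> v \<in> Y_products p}"

text \<open>Multiples of monomials in the \<open>x i * y i\<close>; the central factor stands in for
  scalars, since \<open>'r\<close> is only a ring.\<close>

definition center_words :: "'r set"
  where "center_words = {c * (X.word w * Y.word w) | c w. \<forall>r. c * r = r * c}"

lemma alphaI: "u \<in> centralizer \<Longrightarrow> v \<in> Y_products p \<Longrightarrow> u * Y.word w * v \<in> alpha p"
  by (auto simp: alpha_def)

lemma betaI: "u \<in> centralizer \<Longrightarrow> v \<in> Y_products p \<Longrightarrow> X.word w * u * v \<in> beta p"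
  by (auto simp: beta_def)

lemma center_wordsE:
  assumes "a \<in> center_words"
  obtains c w where "a = c * (X.word w * Y.word w)" "\<forall>r. r * c = c * r"
  using assms that unfolding center_words_def mem_Collect_eq by metis

lemma prod_list_letters: "prod_list (map (\<lambda>i. x i * y i) w) = X.word w * Y.word w"
  by (induction w) (simp_all add: mult.assoc X_word_y[THEN commute_left, symmetric])

lemma centralizer_mult: "u \<in> centralizer \<Longrightarrow> u' \<in> centralizer \<Longrightarrow> u * u' \<in> centralizer"
  by (simp add: centralizer_def) (metis mult.assoc)

lemma center_subset_centralizer: "(\<forall>r. c * r = r * c) \<Longrightarrow> c \<in> centralizer"
  by (simp add: centralizer_def)

lemma X_diff_centralizer: "X.diff v * X.diff w \<in> centralizer"
proof -
  have "X.diff v * X.diff w * x i = x i * (X.diff v * X.diff w)"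
    "X.diff v * X.diff w * y i = y i * (X.diff v * X.diff w)"
    "X.diff v * X.diff w * f i = f i * (X.diff v * X.diff w)" for i
    using X.x_diff[of i] by (metis mult.assoc, metis X_diff_y mult.assoc, metis X_diff_f mult.assoc)
  then show ?thesis
    by (simp add: centralizer_def)
qed

lemma centralizer_commutes:
  assumes "u \<in> centralizer"
  shows "u * X.word w = X.word w * u" "u * Y.word w = Y.word w * u" "u * Y.diff w = Y.diff w * u"
  using assms X.commutes_word[of u w] Y.commutes_word[of u w] Y.commutes_diff[of u w]
  by (auto simp: centralizer_def)

lemma X_word_Y:
  "X.word v * Y.word w = Y.word w * X.word v" "X.word v * Y.diff w = Y.diff w * X.word v"
  using Y.commutes_word[of "X.word v" w] Y.commutes_diff[of "X.word v" w]
  by (auto simp: X_word_y X_word_f)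

lemma commutes_prod_diff:
  "(\<And>w. a * Y.diff w = Y.diff w * a)
    \<Longrightarrow> a * prod_list (map Y.diff ws) = prod_list (map Y.diff ws) * a"
  by (rule commutes_prod_list) auto

lemma Y_products_commutes:
  assumes "v \<in> Y_products p"
  shows "v * X.word w = X.word w * v" "v * Y.word w = Y.word w * v"
    "u \<in> centralizer \<Longrightarrow> v * u = u * v"
  using assms commutes_prod_diff[of "X.word w"] commutes_prod_diff[of "Y.word w"]
    commutes_prod_diff[of u]
  by (auto simp: Y_products_def X_word_Y Y.word_diff centralizer_commutes)

lemma Y_products_Suc: "v \<in> Y_products p \<Longrightarrow> Y.diff b * Y.diff c * v \<in> Y_products (Suc p)"
proof -
  assume "v \<in> Y_products p"
  then obtain ws where "v = prod_list (map Y.diff ws)" "length ws = 2 * p"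
    by (auto simp: Y_products_def)
  then show ?thesis
    unfolding Y_products_def by (intro CollectI exI[of _ "b # c # ws"]) (simp add: mult.assoc)
qed

text \<open>The bracket falls on the \<open>y\<close>-words alone and creates two factors
  \<open>Y.diff\<close>, which raises the degree; the \<open>x\<close>-word of \<open>z\<close>
  survives.\<close>

lemma commutator_alpha:
  assumes "a \<in> alpha p" "z \<in> center_words"
  shows "commutator a z \<in> beta (Suc p)"
proof -
  obtain u b v where a: "a = u * Y.word b * v" and u: "u \<in> centralizer" and v: "v \<in> Y_products p"
    using assms(1) by (auto simp: alpha_def)
  obtain c w where z: "z = c * (X.word w * Y.word w)" and c: "\<forall>r. r * c = c * r"
    using assms(2) by (rule center_wordsE)
  note c = c[rule_format]
  note rules = c centralizer_commutes(1)[OF u] Y_products_commutes(1,2)[OF v]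
    Y_products_commutes(3)[OF v u] centralizer_commutes(2)[OF u, symmetric] X_word_Y(1)[symmetric]
  have "commutator a z = c * (X.word w * (u * ((Y.word b * Y.word w - Y.word w * Y.word b) * v)))"
    unfolding commutator_def a z right_diff_distrib left_diff_distrib
    by (simp only: mult.assoc rules rules[THEN commute_left])
  also have "\<dots> = X.word w * (c * u) * (Y.diff b * Y.diff w * v)"
    by (simp only: Y.commutator_word mult.assoc c c[THEN commute_left])
  finally show ?thesis
    using c by (simp add: betaI u v Y_products_Suc center_subset_centralizer centralizer_mult)
qed

text \<open>Now the bracket falls on the \<open>x\<close>-words; the new factors
  \<open>X.diff\<close> are absorbed into the coefficient, so the degree stays.\<close>

lemma commutator_beta:
  assumes "a \<in> beta p" "z \<in> center_words"
  shows "commutator a z \<in> alpha p"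
proof -
  obtain u b v where a: "a = X.word b * u * v" and u: "u \<in> centralizer" and v: "v \<in> Y_products p"
    using assms(1) by (auto simp: beta_def)
  obtain c w where z: "z = c * (X.word w * Y.word w)" and c: "\<forall>r. r * c = c * r"
    using assms(2) by (rule center_wordsE)
  note c = c[rule_format]
  note rules = c centralizer_commutes(1)[OF u] Y_products_commutes(1,2)[OF v]
    Y_products_commutes(3)[OF v u] centralizer_commutes(2)[OF u, symmetric] X_word_Y(1)[symmetric]
  have "commutator a z = c * ((X.word b * X.word w - X.word w * X.word b) * (u * (Y.word w * v)))"
    unfolding commutator_def a z right_diff_distrib left_diff_distrib
    by (simp only: mult.assoc rules rules[THEN commute_left])
  also have "\<dots> = (c * (X.diff b * X.diff w) * u) * Y.word w * v"
    by (simp only: X.commutator_word mult.assoc)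
  finally show ?thesis
    using c by (simp add: alphaI u v center_subset_centralizer centralizer_mult X_diff_centralizer)
qed

lemma commutator_center_words:
  assumes "a \<in> center_words" "z \<in> center_words"
  shows "commutator a z \<in> add_span (alpha 0 \<union> beta 1)"
proof -
  obtain c v where a: "a = c * (X.word v * Y.word v)" and c: "\<forall>r. r * c = c * r"
    using assms(1) by (rule center_wordsE)
  note c = c[rule_format]
  obtain d w where z: "z = d * (X.word w * Y.word w)" and d: "\<forall>r. r * d = d * r"
    using assms(2) by (rule center_wordsE)
  note d = d[rule_format]
  have one: "1 \<in> Y_products 0"
    by (simp add: Y_products_def)
  define k where "k = c * d"
  have k: "r * k = k * r" for r
    unfolding k_def by (metis c d mult.assoc)
  then have k': "k \<in> centralizer"
    by (simp add: center_subset_centralizer)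
  have "a * z = k * ((X.word v * X.word w) * (Y.word v * Y.word w))"
    unfolding a z k_def
    by (simp only: mult.assoc d[of "X.word _"] d[of "Y.word _"]
        d[of "X.word _", THEN commute_left] d[of "Y.word _", THEN commute_left]
        X_word_Y(1)[symmetric, THEN commute_left])
  moreover have "z * a = k * ((X.word w * X.word v) * (Y.word w * Y.word v))"
    unfolding a z k_def
    by (simp only: mult.assoc c[of "X.word _"] c[of "Y.word _"] c[of d]
        c[of "X.word _", THEN commute_left] c[of "Y.word _", THEN commute_left]
        c[of d, THEN commute_left] X_word_Y(1)[symmetric, THEN commute_left])
  \<comment> \<open>The only bracket in which both kinds of words are noncommuting at once: the
    Leibniz rule splits it into one summand of each type.\<close>
  ultimately have "commutator a z
      = k * ((X.word v * X.word w - X.word w * X.word v) * (Y.word v * Y.word w))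
        + X.word w * X.word v * (k * (Y.word v * Y.word w - Y.word w * Y.word v))"
    by (simp add: commutator_def algebra_simps k[of "X.word _", THEN commute_left])
  also have "\<dots> = (k * (X.diff v * X.diff w)) * Y.word (v @ w) * 1
      + X.word (w @ v) * k * (Y.diff v * Y.diff w * 1)"
    by (simp add: X.commutator_word Y.commutator_word mult.assoc)
  also have "\<dots> \<in> add_span (alpha 0 \<union> beta 1)"
    using Y_products_Suc[OF one] unfolding One_nat_def
    by (intro add_span_add[OF add_span_base[OF UnI1] add_span_base[OF UnI2]] alphaI betaI centralizer_mult
        X_diff_centralizer one k')
  finally show ?thesis .
qed

text \<open>Two chains run in parallel, starting in \<open>alpha 0\<close> and \<open>beta 1\<close>
  and swapping types at each step. Each gains one pair in every two steps.\<close>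

lemma left_normed_commutator_in_span:
  assumes "set as \<subseteq> add_span center_words"
  shows "(length as = 2 * p + 2 \<longrightarrow> left_normed_commutator as \<in> add_span (alpha p \<union> beta (Suc p))) \<and>
    (length as = 2 * p + 3 \<longrightarrow> left_normed_commutator as \<in> add_span (alpha (Suc p) \<union> beta (Suc p)))"
proof -
  have even: "commutator a z \<in> add_span (alpha (Suc p) \<union> beta (Suc p))"
    if "a \<in> add_span (alpha p \<union> beta (Suc p))" "z \<in> add_span center_words" for a z p
    using commutator_alpha commutator_beta that
    by (intro commutator_add_span[OF _ that]) (auto intro!: add_span_base)
  have odd: "commutator a z \<in> add_span (alpha p \<union> beta (Suc p))"
    if "a \<in> add_span (alpha p \<union> beta p)" "z \<in> add_span center_words" for a z p
    using commutator_alpha commutator_beta that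
    by (intro commutator_add_span[OF _ that]) (auto intro!: add_span_base)
  show ?thesis
    using assms
  proof (induction as arbitrary: p rule: rev_induct)
    case (snoc z as)
    then have z: "z \<in> add_span center_words" and as: "set as \<subseteq> add_span center_words"
      by auto
    show ?case
    proof (intro conjI impI)
      assume "length (as @ [z]) = 2 * p + 3"
      then have len: "length as = 2 * p + 2"
        by simp
      then show "left_normed_commutator (as @ [z]) \<in> add_span (alpha (Suc p) \<union> beta (Suc p))"
        using snoc.IH[OF as, of p] even z by (simp add: left_normed_commutator_snoc)
    next
      assume len: "length (as @ [z]) = 2 * p + 2"
      show "left_normed_commutator (as @ [z]) \<in> add_span (alpha p \<union> beta (Suc p))"
      proof (cases p)
        case 0
        with len obtain a where "as = [a]"
          by (auto simp: length_Suc_conv)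
        with 0 as z show ?thesis
          using commutator_add_span[OF commutator_center_words]
          by (simp add: left_normed_commutator_def)
      next
        case (Suc q)
        with len have "length as = 2 * q + 3"
          by simp
        with Suc show ?thesis
          using snoc.IH[OF as, of q] odd z by (simp add: left_normed_commutator_snoc)
      qed
    qed
  qed simp
qed

text \<open>Every summand contains \<open>2 * Suc p\<close> factors \<open>Y.diff\<close>, more than
  there are nonzero \<open>f i\<close>.\<close>

lemma left_normed_commutator_eq_0:
  assumes A: "finite A" "\<And>i. i \<notin> A \<Longrightarrow> f i = 0"
    and "set as \<subseteq> add_span center_words"
    and len: "length as = 2 * p + 3" "card A < 2 * Suc p"
  shows "left_normed_commutator as = 0"
proof -
  have "Y_products (Suc p) \<subseteq> {0}"
    using Y.prod_diff_eq_0[OF A] len(2) by (auto simp: Y_products_def)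
  then have "alpha (Suc p) \<union> beta (Suc p) \<subseteq> {0}"
    by (auto simp: alpha_def beta_def)
  moreover have "s = 0" if "s \<in> add_span {0}" for s :: 'r
    using that by induction auto
  ultimately show ?thesis
    using left_normed_commutator_in_span[OF assms(3), of p] len(1) add_span_mono by blast
qed


end

section \<open>An explicit commutator that does not vanish\<close>

locale nat_exterior_pair = exterior_pair x e y f for x e y f :: "nat \<Rightarrow> 'r :: ring_1"
begin

text \<open>Since \<open>y a = 1\<close>, the first bracket yields only the \<open>e\<close> part.
  After that, the trailing \<open>y\<close> keeps the recursion going: one bracket turns it into
  \<open>f k * f (k + 1)\<close> and leaves an \<open>x\<close>, the next turns that
  \<open>x\<close> into two letters \<open>e\<close> and leaves a new \<open>y\<close>.\<close>

lemma left_normed_commutator_upt_gen: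
  assumes "y a = 1"
  shows "left_normed_commutator (map (\<lambda>i. x i * y i) [a..<a + 2 * j + 2])
    = prod_list (map e [a..<a + 2 * j + 2]) * prod_list (map f [a + 1..<a + 2 * j + 1])
      * y (a + 2 * j + 1)"
proof (induction j)
  case 0
  have "left_normed_commutator (map (\<lambda>i. x i * y i) [a..<a + 2])
      = (x a * x (a + 1) - x (a + 1) * x a) * y (a + 1)"
    by (simp add: left_normed_commutator_def commutator_def assms upt_conv_Cons algebra_simps)
      (simp add: x_y)
  then show ?case
    by (simp add: X.commutator_x upt_conv_Cons)
next
  case (Suc j)
  define k where "k = a + 2 * j + 1"
  define E F where "E = prod_list (map e [a..<k + 1])" and "F = prod_list (map f [a + 1..<k])"
  have C: "left_normed_commutator (map (\<lambda>i. x i * y i) [a..<k + 1]) = E * F * y k"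
    using Suc by (simp add: k_def E_def F_def)
  have "a < k"
    by (simp add: k_def)
  then have upt: "map (\<lambda>i. x i * y i) [a..<a + 2 * Suc j + 2]
      = (map (\<lambda>i. x i * y i) [a..<k + 1] @ [x (k + 1) * y (k + 1)]) @ [x (k + 2) * y (k + 2)]"
    by (simp add: k_def)
  have E: "prod_list (map e [a..<a + 2 * Suc j + 2]) = E * (e (k + 1) * e (k + 2))"
    using \<open>a < k\<close> by (simp add: E_def k_def mult.assoc)
  have F: "prod_list (map f [a + 1..<a + 2 * Suc j + 1]) = F * (f k * f (k + 1))"
    using \<open>a < k\<close> by (simp add: F_def k_def mult.assoc)
  have E_x: "x i * E = E * x i" and E_y: "y i * E = E * y i"
    and F_x: "x i * F = F * x i" and F_y: "y i * F = F * y i" and F_e: "e i * F = F * e i" for i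
    unfolding E_def F_def
    by (rule commutes_prod_list; auto simp: X.e_x Y.e_x x_f e_y e_f)+
  have "commutator (E * F * y k) (x (k + 1) * y (k + 1))
      = E * (F * (x (k + 1) * (y k * y (k + 1) - y (k + 1) * y k)))"
    unfolding commutator_def right_diff_distrib left_diff_distrib
    by (simp only: mult.assoc E_x E_y F_x F_y E_x[THEN commute_left] E_y[THEN commute_left]
        F_x[THEN commute_left] F_y[THEN commute_left] x_y[symmetric] x_y[symmetric, THEN commute_left])
  also have "\<dots> = E * (F * (x (k + 1) * (f k * f (k + 1))))"
    by (simp only: Y.commutator_x)
  finally have 1: "commutator (E * F * y k) (x (k + 1) * y (k + 1))
      = E * (F * (x (k + 1) * (f k * f (k + 1))))" .
  have "commutator (E * (F * (x (k + 1) * (f k * f (k + 1))))) (x (k + 2) * y (k + 2))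
      = E * (F * ((x (k + 1) * x (k + 2) - x (k + 2) * x (k + 1)) * (f k * (f (k + 1) * y (k + 2)))))"
    unfolding commutator_def right_diff_distrib left_diff_distrib
    by (simp only: mult.assoc E_x E_y F_x F_y E_x[THEN commute_left] E_y[THEN commute_left]
        F_x[THEN commute_left] F_y[THEN commute_left] x_y[symmetric] x_y[symmetric, THEN commute_left]
        x_f[symmetric] x_f[symmetric, THEN commute_left] Y.e_x[symmetric] Y.e_x[symmetric, THEN commute_left])
  also have "\<dots> = E * (e (k + 1) * e (k + 2)) * (F * (f k * f (k + 1))) * y (k + 2)"
    by (simp only: X.commutator_x mult.assoc F_e F_e[THEN commute_left])
  finally have 2: "commutator (E * (F * (x (k + 1) * (f k * f (k + 1))))) (x (k + 2) * y (k + 2))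
      = E * (e (k + 1) * e (k + 2)) * (F * (f k * f (k + 1))) * y (k + 2)" .
  have len: "2 \<le> length (map (\<lambda>i. x i * y i) [a..<k + 1])"
    "2 \<le> length (map (\<lambda>i. x i * y i) [a..<k + 1] @ [x (k + 1) * y (k + 1)])"
    using \<open>a < k\<close> by simp_all
  show ?case
    unfolding upt E F left_normed_commutator_snoc[OF len(2)] left_normed_commutator_snoc[OF len(1)]
      C 1 2
    by (simp add: k_def)
qed

corollary left_normed_commutator_upt:
  assumes "0 < j" "y a = 1" "y (a + 2 * j - 1) = 1"
  shows "left_normed_commutator (map (\<lambda>i. x i * y i) [a..<a + 2 * j])
    = prod_list (map e [a..<a + 2 * j]) * prod_list (map f [a + 1..<a + 2 * j - 1])"
proof -
  obtain k where j: "j = Suc k"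
    using assms(1) gr0_implies_Suc by blast
  have "a + 2 * j = a + 2 * k + 2" "a + 2 * j - 1 = a + 2 * k + 1"
    by (simp_all add: j)
  then show ?thesis
    using left_normed_commutator_upt_gen[OF assms(2), of k] assms(3) by (simp only: mult_1_right)
qed

lemma prod_f_prod_e:
  "prod_list (map f v) * prod_list (map e w) = prod_list (map e w) * prod_list (map f v)"
  by (intro commutes_prod_list) (auto intro!: commutes_prod_list[symmetric] simp: e_f)

end

section \<open>A model\<close>

lemma anticommute_mult:
  fixes a b c :: "'r :: ring"
  assumes "a * b = - (b * a)" "a * c = - (c * a)"
  shows "a * (b * c) = b * c * a"
proof -
  have "a * (b * c) = a * b * c"
    by (simp add: mult.assoc)
  also have "\<dots> = - (b * (a * c))"
    by (simp only: assms(1)) (simp add: mult.assoc)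
  finally show ?thesis
    by (simp only: assms(2)) (simp add: mult.assoc)
qed

text \<open>
  Half of the commutator \<open>2 e\<^sub>i e\<^sub>j\<close> that the symmetric choice \<open>t\<^sub>i + e\<^sub>i \<Sum>\<^sub>j e\<^sub>j D\<^sub>j\<close> would give is obtained by
  restricting the sum to \<open>j > i\<close>; this makes the construction independent of the characteristic.
\<close>

locale weyl_exterior =
  fixes e t D :: "'i :: linorder \<Rightarrow> 'r :: ring_1" and A :: "'i set"
  assumes e_anticommute: "e i * e j = - (e j * e i)"
    and e_square: "e i * e i = 0"
    and e_t: "e i * t j = t j * e i"
    and e_D: "e i * D j = D j * e i"
    and t_t: "t i * t j = t j * t i"
    and D_D: "D i * D j = D j * D i"
    and D_t: "D i * t j - t j * D i = (if i = j then 1 else 0)"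
    and finite_A: "finite A"
begin

definition eta :: "'i \<Rightarrow> 'r"
  where "eta i = (\<Sum>j\<in>{j \<in> A. i < j}. e j * D j)"

text \<open>The value 1 outside \<open>A\<close>, where \<open>e_on\<close> is 0, respects the
  axioms of \<open>exterior_system\<close> and later supplies the indices with
  \<open>y i = 1\<close>.\<close>

definition x :: "'i \<Rightarrow> 'r"
  where "x i = (if i \<in> A then t i + e i * eta i else 1)"

definition e_on :: "'i \<Rightarrow> 'r"
  where "e_on i = (if i \<in> A then e i else 0)"

lemma e_eta: "e i * eta j = - (eta j * e i)"
proof -
  have "e i * (e k * D k) = - (e k * D k * e i)" for k
  proof -
    have "e i * (e k * D k) = (e i * e k) * D k"
      by (simp add: mult.assoc)
    also have "\<dots> = - (e k * (e i * D k))"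
      by (subst e_anticommute) (simp add: mult.assoc)
    finally show ?thesis
      by (simp only: e_D[of i k] mult.assoc)
  qed
  then show ?thesis
    by (simp add: eta_def sum_distrib_left sum_distrib_right sum_negf)
qed

lemma D_eta: "D i * eta j = eta j * D i"
  unfolding eta_def sum_distrib_left sum_distrib_right
  by (rule sum.cong) (simp_all add: mult.assoc D_D e_D[THEN commute_left, symmetric])

lemma eta_eta: "eta i * eta j = - (eta j * eta i)"
proof -
  have "eta i * (e k * D k) = - (e k * D k * eta i)" for k
  proof -
    have "eta i * (e k * D k) = - (e k * eta i) * D k"
      by (simp add: e_eta flip: mult.assoc)
    then show ?thesis
      by (simp add: D_eta mult.assoc)
  qed
  then show ?thesis
    by (simp add: eta_def[of j] sum_distrib_left sum_distrib_right sum_negf)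
qed

text \<open>\<open>D k\<close> acts as the partial derivative in \<open>t k\<close>, so the bracket
  with \<open>t j\<close> extracts the coefficient of \<open>D j\<close> in
  \<open>eta i\<close>.\<close>

lemma eta_t:
  assumes "j \<in> A"
  shows "eta i * t j - t j * eta i = (if i < j then e j else 0)"
proof -
  have "eta i * t j - t j * eta i = (\<Sum>k\<in>{k \<in> A. i < k}. e k * (D k * t j - t j * D k))"
    by (simp add: eta_def sum_distrib_left sum_distrib_right right_diff_distrib mult.assoc
        e_t[THEN commute_left] flip: sum_subtractf)
  also have "\<dots> = (\<Sum>k\<in>{k \<in> A. i < k}. if k = j then e k else 0)"
    by (rule sum.cong) (simp_all add: D_t)
  finally show ?thesis
    using assms finite_A by (simp add: sum.delta)
qed

lemma e_x: "e i * x j = x j * e i"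
proof -
  have "e i * (e j * eta j) = e j * eta j * e i"
    by (rule anticommute_mult[OF e_anticommute e_eta])
  then show ?thesis
    by (simp add: x_def e_t distrib_left distrib_right)
qed

lemma e_eta_commute: "e i * eta i * (e j * eta j) = e j * eta j * (e i * eta i)"
proof -
  have "eta i * e j = - (e j * eta i)"
    by (simp add: e_eta)
  then have "eta i * (e j * eta j) = e j * eta j * eta i"
    by (rule anticommute_mult[OF _ eta_eta])
  moreover have "e i * (e j * eta j) = e j * eta j * e i"
    by (rule anticommute_mult[OF e_anticommute e_eta])
  ultimately show ?thesis
    by (metis mult.assoc)
qed

lemma commutator_x:
  assumes "i \<in> A" "j \<in> A"
  shows "x i * x j - x j * x i = e i * e j"
proof -
  have t_e: "t k * (e l * eta l) = e l * (t k * eta l)" for k l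
    by (rule commute_left) (simp add: e_t)
  have "x i * x j - x j * x i
      = (t i * t j - t j * t i) + (e i * eta i * t j - t j * (e i * eta i))
        - (e j * eta j * t i - t i * (e j * eta j))
        + (e i * eta i * (e j * eta j) - e j * eta j * (e i * eta i))"
    using assms by (simp add: x_def algebra_simps)
  also have "\<dots> = e i * (eta i * t j - t j * eta i) - e j * (eta j * t i - t i * eta j)"
    by (simp only: t_t[of i j] t_e e_eta_commute[of i j]) (simp add: right_diff_distrib mult.assoc)
  \<comment> \<open>For distinct indices exactly one term survives, namely \<open>e i * e j\<close>
    if \<open>i < j\<close> and \<open>- (e j * e i)\<close> if \<open>j < i\<close>; for
    \<open>i = j\<close> both sides are 0.\<close>
  also have "\<dots> = e i * e j"
    using assms e_anticommute[of j i] e_square[of i] by (auto simp: eta_t)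
  finally show ?thesis .
qed

lemma exterior_system: "exterior_system x e_on"
proof
  show "x i * x j - x j * x i = e_on i * e_on j" for i j
    using commutator_x by (cases "i \<in> A"; cases "j \<in> A") (auto simp: e_on_def x_def)
qed (auto simp: e_on_def e_square e_x intro: e_anticommute)

lemma commutes_x:
  assumes "\<And>i. a * e i = e i * a" "\<And>i. a * t i = t i * a" "\<And>i. a * D i = D i * a"
  shows "a * x i = x i * a"
proof -
  have "a * eta i = eta i * a"
    unfolding eta_def sum_distrib_left sum_distrib_right
    by (rule sum.cong) (simp_all add: mult.assoc assms assms(1)[THEN commute_left])
  then show ?thesis
    by (simp add: x_def distrib_left distrib_right mult.assoc assms assms(1)[THEN commute_left])
qed

lemma commutes_e_on: "(\<And>i. a * e i = e i * a) \<Longrightarrow> a * e_on i = e_on i * a"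
  by (simp add: e_on_def)

end

section \<open>Linear operators on function spaces\<close>

typedef (overloaded) ('s, 'a :: field) linear_op =
  "{T :: ('s \<Rightarrow> 'a) \<Rightarrow> 's \<Rightarrow> 'a.
    (\<forall>f g. T (\<lambda>s. f s + g s) = (\<lambda>s. T f s + T g s)) \<and> (\<forall>c f. T (\<lambda>s. c * f s) = (\<lambda>s. c * T f s))}"
  by (rule exI[of _ "\<lambda>f s. 0"]) simp

setup_lifting type_definition_linear_op

instantiation linear_op :: (type, field) ring_1
begin

lift_definition zero_linear_op :: "('a, 'b) linear_op" is "\<lambda>f s. 0"
  by simp

lift_definition one_linear_op :: "('a, 'b) linear_op" is "\<lambda>f. f"
  by simp

lift_definition plus_linear_op :: "('a, 'b) linear_op \<Rightarrow> ('a, 'b) linear_op \<Rightarrow> ('a, 'b) linear_op"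
  is "\<lambda>T U f s. T f s + U f s"
  by (simp add: algebra_simps)

lift_definition uminus_linear_op :: "('a, 'b) linear_op \<Rightarrow> ('a, 'b) linear_op"
  is "\<lambda>T f s. - T f s"
  by simp

lift_definition minus_linear_op :: "('a, 'b) linear_op \<Rightarrow> ('a, 'b) linear_op \<Rightarrow> ('a, 'b) linear_op"
  is "\<lambda>T U f s. T f s - U f s"
  by (simp add: algebra_simps)

lift_definition times_linear_op :: "('a, 'b) linear_op \<Rightarrow> ('a, 'b) linear_op \<Rightarrow> ('a, 'b) linear_op"
  is "\<lambda>T U f. T (U f)"
  by simp

instance
proof
  show "(0 :: ('a, 'b) linear_op) \<noteq> 1"
    by transfer (metis zero_neq_one)
qed (transfer; auto simp: algebra_simps)+

end

lift_definition weighted_shift :: "('s \<Rightarrow> 'a) \<Rightarrow> ('s \<Rightarrow> 's) \<Rightarrow> ('s, 'a :: field) linear_op"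
  is "\<lambda>c \<tau> f s. c s * f (\<tau> s)"
  by (simp add: algebra_simps)

lift_definition apply_op :: "('s, 'a :: field) linear_op \<Rightarrow> ('s \<Rightarrow> 'a) \<Rightarrow> 's \<Rightarrow> 'a"
  is "\<lambda>T. T" .

lemma apply_op_simps [simp]:
  "apply_op 0 f s = 0" "apply_op 1 f = f" "apply_op (S * T) f = apply_op S (apply_op T f)"
  "apply_op (weighted_shift c \<tau>) f s = c s * f (\<tau> s)"
  "apply_op (S + T) f s = apply_op S f s + apply_op T f s"
  "apply_op (S - T) f s = apply_op S f s - apply_op T f s"
  "apply_op (- T) f s = - apply_op T f s"
  by (transfer; simp)+

lemma linear_op_eqI: "(\<And>f s. apply_op S f s = apply_op T f s) \<Longrightarrow> S = T"
  by transfer blast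

definition scalar_op :: "'a \<Rightarrow> ('s, 'a :: field) linear_op"
  where "scalar_op c = weighted_shift (\<lambda>s. c) (\<lambda>s. s)"

lemma scalar_op_commutes: "scalar_op c * T = T * scalar_op c"
  unfolding scalar_op_def by transfer simp

lemma scalar_op_simps:
  "scalar_op 0 = 0" "scalar_op 1 = 1" "scalar_op (a + b) = scalar_op a + scalar_op b"
  "scalar_op (a * b) = scalar_op a * scalar_op b"
  by (auto intro!: linear_op_eqI simp: scalar_op_def algebra_simps)

section \<open>Exterior multiplication and Weyl operators on coefficient functions\<close>

text \<open>
  A state \<open>(S, \<alpha>)\<close> is a monomial of the exterior algebra together with an exponent vector; the label
  \<open>'l\<close> separates commuting copies.
\<close>

type_synonym 'l state = "('l \<times> nat) set \<times> ('l \<times> nat \<Rightarrow> nat)"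

text \<open>The sign of sorting a new generator into a monomial. Only generators with the same label
  are passed, so different labels commute; the count is finite even for infinite
  \<open>S\<close>.\<close>

definition sign :: "'l \<times> nat \<Rightarrow> ('l \<times> nat) set \<Rightarrow> 'a :: field"
  where "sign k S = (- 1) ^ card {j. j < snd k \<and> (fst k, j) \<in> S}"

text \<open>Left multiplication by a Grassmann generator: the coefficient of the product at
  \<open>S\<close> comes from \<open>S\<close> without that generator.\<close>

definition wedge :: "'l \<Rightarrow> nat \<Rightarrow> ('l state, 'a :: field) linear_op"
  where "wedge b i = weighted_shift
    (\<lambda>(S, \<alpha>). if (b, i) \<in> S then sign (b, i) S else 0) (\<lambda>(S, \<alpha>). (S - {(b, i)}, \<alpha>))"

text \<open>In terms of divided powers, \<open>raise\<close> is multiplication by a variable and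
  \<open>lower\<close> is differentiation. At exponent 0 the factor \<open>of_nat 0\<close> hides
  the truncated subtraction.\<close>

definition raise :: "'l \<Rightarrow> nat \<Rightarrow> ('l state, 'a :: field) linear_op"
  where "raise b i = weighted_shift
    (\<lambda>(S, \<alpha>). of_nat (\<alpha> (b, i))) (\<lambda>(S, \<alpha>). (S, \<alpha>((b, i) := \<alpha> (b, i) - 1)))"

definition lower :: "'l \<Rightarrow> nat \<Rightarrow> ('l state, 'a :: field) linear_op"
  where "lower b i = weighted_shift
    (\<lambda>(S, \<alpha>). 1) (\<lambda>(S, \<alpha>). (S, \<alpha>((b, i) := \<alpha> (b, i) + 1)))"

lemma sign_remove:
  "sign (b, i) (S - {(c, j)}) = (if c = b \<and> j < i \<and> (c, j) \<in> S then - sign (b, i) S else sign (b, i) S)"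
proof (cases "c = b \<and> j < i \<and> (c, j) \<in> S")
  case True
  have "{k. k < i \<and> (b, k) \<in> S} = insert j {k. k < i \<and> (b, k) \<in> S - {(c, j)}}"
    using True by auto
  moreover have "j \<notin> {k. k < i \<and> (b, k) \<in> S - {(c, j)}}"
    using True by simp
  ultimately have "card {k. k < i \<and> (b, k) \<in> S} = Suc (card {k. k < i \<and> (b, k) \<in> S - {(c, j)}})"
    by simp
  then show ?thesis
    unfolding sign_def fst_conv snd_conv if_P[OF True] by simp
next
  case False
  then have "{k. k < i \<and> (b, k) \<in> S - {(c, j)}} = {k. k < i \<and> (b, k) \<in> S}"
    by auto
  then show ?thesis
    unfolding sign_def fst_conv snd_conv if_not_P[OF False] by simp
qed

lemma wedge_wedge:
  fixes b c :: 'l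
  shows "wedge b i * wedge c j = 
    (if b = c then - (wedge c j * wedge b i) else wedge c j * wedge b i :: ('l state, 'a :: field) linear_op)"
proof (rule linear_op_eqI)
  fix f :: "'l state \<Rightarrow> 'a" and s :: "'l state"
  obtain S \<alpha> where s: "s = (S, \<alpha>)"
    by (cases s)
  have remove: "S - {p} - {q} = S - {q} - {p}" for p q
    by blast
  show "apply_op (wedge b i * wedge c j) f s
      = apply_op (if b = c then - (wedge c j * wedge b i) else wedge c j * wedge b i) f s"
    \<comment> \<open>For equal labels, removing the smaller index flips the sign of the larger one,
      and not conversely.\<close>
    by (cases i j rule: linorder_cases) (auto simp: s wedge_def sign_remove remove)
qed

lemma wedge_wedge_distinct: "b \<noteq> c \<Longrightarrow> wedge b i * wedge c j = wedge c j * wedge b i"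
  by (simp add: wedge_wedge[of b i c])

lemma wedge_square: "wedge b i * wedge b i = 0"
  by (rule linear_op_eqI) (auto simp: wedge_def)

lemma wedge_raise: "wedge b i * raise c j = raise c j * wedge b i"
  by (rule linear_op_eqI) (auto simp: wedge_def raise_def)

lemma wedge_lower: "wedge b i * lower c j = lower c j * wedge b i"
  by (rule linear_op_eqI) (auto simp: wedge_def lower_def)

lemma raise_raise: "raise b i * raise c j = raise c j * raise b i"
  by (rule linear_op_eqI) (auto simp: raise_def fun_upd_twist)

lemma lower_lower: "lower b i * lower c j = lower c j * lower b i"
  by (rule linear_op_eqI) (auto simp: lower_def fun_upd_twist)

lemma lower_raise:
  fixes b c :: 'l
  shows "lower b i * raise c j - raise c j * lower b i
    = (if b = c \<and> i = j then 1 else 0 :: ('l state, 'a :: field) linear_op)"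
proof (rule linear_op_eqI)
  fix f :: "'l state \<Rightarrow> 'a" and s :: "'l state"
  obtain S \<alpha> where s: "s = (S, \<alpha>)"
    by (cases s)
  show "apply_op (lower b i * raise c j - raise c j * lower b i) f s
      = apply_op (if b = c \<and> i = j then 1 else 0) f s"
  proof (cases "b = c \<and> i = j")
    case True
    then show ?thesis
      by (cases "\<alpha> (b, i)") (auto simp: s lower_def raise_def fun_upd_idem algebra_simps)
  next
    case False
    then show ?thesis
      by (auto simp: s lower_def raise_def fun_upd_twist)
  qed
qed

lemma lower_raise_distinct: "b \<noteq> c \<Longrightarrow> lower b i * raise c j = raise c j * lower b i"
  using lower_raise[of b i c j] by simp

text \<open>Applied to the constant function 1, each factor contributes a sign and removes its
  generator from \<open>S\<close>; by distinctness the remaining generators are still there.\<close>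

lemma prod_wedge_nonzero:
  assumes "distinct ks" "set ks \<subseteq> S"
  shows "apply_op (prod_list (map (\<lambda>(b, i). wedge b i) ks)) (\<lambda>s. 1) (S, \<alpha>) \<noteq> (0 :: 'a :: field)"
  using assms
proof (induction ks arbitrary: S)
  case (Cons k ks)
  obtain b i where k: "k = (b, i)"
    by fastforce
  have "set ks \<subseteq> S - {(b, i)}"
    using Cons.prems k by auto
  with Cons k show ?case
    by (simp add: wedge_def sign_def)
qed simp

lemma exists_exterior_pair:
  fixes A B :: "nat set"
  assumes "finite A" "finite B"
  obtains x e y f :: "nat \<Rightarrow> (bool state, 'a :: field) linear_op"
  where "exterior_pair x e y f"
    and "\<forall>i. i \<notin> B \<longrightarrow> y i = 1 \<and> f i = 0"
    and "\<forall>v w. distinct v \<longrightarrow> set v \<subseteq> A \<longrightarrow> distinct w \<longrightarrow> set w \<subseteq> B \<longrightarrow>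
      prod_list (map e v) * prod_list (map f w) \<noteq> 0"
proof -
  have weyl: "weyl_exterior (wedge b :: nat \<Rightarrow> (bool state, 'a) linear_op) (raise b) (lower b) C" if "finite C"
    for C :: "nat set" and b :: bool
  proof
    show "wedge b i * wedge b j = - (wedge b j * wedge b i)" for i j
      by (subst wedge_wedge) simp
    show "lower b i * raise b j - raise b j * lower b i = (if i = j then 1 else 0)" for i j
      by (simp add: lower_raise)
  qed (fact that wedge_square wedge_raise wedge_lower raise_raise lower_lower)+
  define x e y f :: "nat \<Rightarrow> (bool state, 'a) linear_op"
    where "x = weyl_exterior.x (wedge False) (raise False) (lower False) A"
    and "e = weyl_exterior.e_on (wedge False) A"
    and "y = weyl_exterior.x (wedge True) (raise True) (lower True) B"
    and "f = weyl_exterior.e_on (wedge True) B"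
  show ?thesis
  proof (rule that[of x e y f])
    interpret X: weyl_exterior "wedge False :: nat \<Rightarrow> (bool state, 'a) linear_op" "raise False" "lower False" A
      by (rule weyl[OF assms(1)])
    interpret Y: weyl_exterior "wedge True :: nat \<Rightarrow> (bool state, 'a) linear_op" "raise True" "lower True" B
      by (rule weyl[OF assms(2)])
    have cross: "wedge True i * X.x j = X.x j * wedge True i"
      "raise True i * X.x j = X.x j * raise True i"
      "lower True i * X.x j = X.x j * lower True i"
      "wedge True i * X.e_on j = X.e_on j * wedge True i"
      "raise True i * X.e_on j = X.e_on j * raise True i"
      "lower True i * X.e_on j = X.e_on j * lower True i" for i j
      by (intro X.commutes_x X.commutes_e_on wedge_wedge_distinct wedge_raise wedge_raise[symmetric]
          wedge_lower wedge_lower[symmetric] raise_raise lower_lower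
          lower_raise_distinct lower_raise_distinct[symmetric]; simp)+
    show "exterior_pair x e y f"
      unfolding x_def e_def y_def f_def exterior_pair_def exterior_pair_axioms_def
      by (intro conjI allI X.exterior_system Y.exterior_system Y.commutes_x Y.commutes_e_on
          cross[symmetric])
    show "\<forall>i. i \<notin> B \<longrightarrow> y i = 1 \<and> f i = 0"
      by (simp add: y_def f_def Y.x_def Y.e_on_def)
    show "\<forall>v w. distinct v \<longrightarrow> set v \<subseteq> A \<longrightarrow> distinct w \<longrightarrow> set w \<subseteq> B \<longrightarrow>
        prod_list (map e v) * prod_list (map f w) \<noteq> 0"
    proof (intro allI impI)
      fix v w
      assume vw: "distinct v" "set v \<subseteq> A" "distinct w" "set w \<subseteq> B"
      let ?ks = "map (Pair False) v @ map (Pair True) w"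
    have "map e v = map (wedge False) v" "map f w = map (wedge True) w"
      using vw by (auto simp: e_def f_def X.e_on_def Y.e_on_def)
    then have "prod_list (map e v) * prod_list (map f w) = prod_list (map (\<lambda>(b, i). wedge b i) ?ks)"
      by (simp only:) (simp add: comp_def)
    moreover have "distinct ?ks"
      using vw by (auto simp: distinct_map inj_on_def)
    ultimately show "prod_list (map e v) * prod_list (map f w) \<noteq> 0"
      using prod_wedge_nonzero[of ?ks UNIV undefined] by (metis apply_op_simps(1) subset_UNIV)
    qed
  qed
qed

section \<open>Evaluation of the free algebra\<close>

definition eval_free :: "('x \<Rightarrow> ('s, 'a) linear_op) \<Rightarrow> ('x, 'a :: field) free_algebra \<Rightarrow> ('s, 'a) linear_op"
  where "eval_free z p
    = (\<Sum>w\<in>Poly_Mapping.keys p. scalar_op (Poly_Mapping.lookup p w) * prod_list (map z (letters w)))"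

lemma eval_free_superset:
  assumes "finite W" "Poly_Mapping.keys p \<subseteq> W"
  shows "eval_free z p
    = (\<Sum>w\<in>W. scalar_op (Poly_Mapping.lookup p w) * prod_list (map z (letters w)))"
  unfolding eval_free_def
  by (rule sum.mono_neutral_left) (use assms in \<open>auto simp: in_keys_iff scalar_op_simps\<close>)

lemma eval_free_add: "eval_free z (p + q) = eval_free z p + eval_free z q"
proof -
  let ?W = "Poly_Mapping.keys p \<union> Poly_Mapping.keys q"
  have "Poly_Mapping.keys (p + q) \<subseteq> ?W"
    by (rule Poly_Mapping.keys_add)
  then show ?thesis
    by (simp add: eval_free_superset[of ?W] lookup_add scalar_op_simps distrib_right sum.distrib)
qed

lemma eval_free_0 [simp]: "eval_free z 0 = 0"
  by (simp add: eval_free_def)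

lemma eval_free_diff: "eval_free z (p - q) = eval_free z p - eval_free z q"
  using eval_free_add[of z "p - q" q] by simp

lemma eval_free_uminus: "eval_free z (- p) = - eval_free z p"
  using eval_free_diff[of z 0 p] by simp

lemma eval_free_sum: "eval_free z (sum g I) = (\<Sum>i\<in>I. eval_free z (g i))"
  by (induction I rule: infinite_finite_induct) (auto simp: eval_free_add)

lemma eval_free_single:
  "eval_free z (Poly_Mapping.single w c) = scalar_op c * prod_list (map z (letters w))"
  by (simp add: eval_free_def scalar_op_simps)

lemma sum_single_lookup:
  "(\<Sum>w\<in>Poly_Mapping.keys p. Poly_Mapping.single w (Poly_Mapping.lookup p w)) = p"
  by (rule poly_mapping_eqI) (simp add: lookup_sum lookup_single when_def in_keys_iff)

lemma eval_free_mult: "eval_free z (p * q) = eval_free z p * eval_free z q"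
proof -
  have single: "eval_free z (Poly_Mapping.single v a * Poly_Mapping.single w b)
      = eval_free z (Poly_Mapping.single v a) * eval_free z (Poly_Mapping.single w b)" for v w a b
    by (simp add: mult_single eval_free_single plus_free_monoid_def scalar_op_simps mult.assoc
        scalar_op_commutes[of _ "prod_list _", THEN commute_left])
  let ?P = "\<Sum>w\<in>Poly_Mapping.keys p. Poly_Mapping.single w (Poly_Mapping.lookup p w)"
  let ?Q = "\<Sum>w\<in>Poly_Mapping.keys q. Poly_Mapping.single w (Poly_Mapping.lookup q w)"
  have "eval_free z (?P * ?Q) = eval_free z ?P * eval_free z ?Q"
    by (simp only: sum_product eval_free_sum single)
  then show ?thesis
    by (simp only: sum_single_lookup)
qed

lemma eval_free_left_normed_commutator:
  assumes "ps \<noteq> []"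
  shows "eval_free z (left_normed_commutator ps) = left_normed_commutator (map (eval_free z) ps)"
proof -
  have "eval_free z (foldl commutator p qs) = foldl commutator (eval_free z p) (map (eval_free z) qs)"
    for p qs
    by (induction qs arbitrary: p) (simp_all add: commutator_def eval_free_diff eval_free_mult)
  with assms show ?thesis
    by (simp add: left_normed_commutator_def hd_map map_tl)
qed

lemma left_normed_commutator_in_T_ideal:
  "length ps = l \<Longrightarrow> left_normed_commutator ps \<in> (T_ideal l :: (nat, 'a :: field) free_algebra set)"
  using ring.genideal_self[OF ring_ring_of_type_algebra,
      of "{left_normed_commutator ps | ps. length ps = l}"]
  unfolding T_ideal_def by (auto simp: ring_of_type_algebra_def)

text \<open>The kernel of the evaluation homomorphism is a two-sided ideal, so it contains
  \<open>T_ideal l\<close> as soon as it contains the generators.\<close>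

lemma eval_free_T_ideal:
  assumes l: "0 < l"
    and vanish: "\<And>ps. length ps = l \<Longrightarrow> left_normed_commutator (map (eval_free z) ps) = 0"
    and p: "p \<in> (T_ideal l :: (nat, 'a :: field) free_algebra set)"
  shows "eval_free z p = 0"
proof -
  let ?R = "ring_of_type_algebra :: (nat, 'a) free_algebra ring"
  interpret R: ring ?R
    by (rule ring_ring_of_type_algebra)
  have "ideal {p. eval_free z p = 0} ?R"
  proof (rule idealI)
    show "subgroup {p. eval_free z p = 0} (add_monoid ?R)"
    proof
      fix p
      assume "p \<in> {p. eval_free z p = 0}"
      moreover have "inv\<^bsub>add_monoid ?R\<^esub> p = - p"
        using R.add.inv_equality[of "- p" p] by (simp add: ring_of_type_algebra_def a_inv_def)
      ultimately show "inv\<^bsub>add_monoid ?R\<^esub> p \<in> {p. eval_free z p = 0}"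
        by (simp add: eval_free_uminus)
    qed (auto simp: ring_of_type_algebra_def eval_free_add)
  qed (auto simp: ring_of_type_algebra_def eval_free_mult intro: ring_ring_of_type_algebra[unfolded ring_of_type_algebra_def])
  moreover have "{left_normed_commutator ps | ps. length ps = l} \<subseteq> {p. eval_free z p = 0}"
    using l vanish by (force simp: eval_free_left_normed_commutator)
  ultimately have "T_ideal l \<subseteq> {p. eval_free z p = 0}"
    unfolding T_ideal_def by (rule R.genideal_minimal)
  with p show ?thesis
    by blast
qed

theorem theorem1p3:
  fixes m n m' n' :: nat
  assumes "m' > 0" and "n' > 0" and "m = 2 * m'" and "n = 2 * n'"
  shows "\<not> ideal_prod ring_of_type_algebra (T_ideal m) (T_ideal n)
           \<subseteq> (T_ideal (m + n - 1) :: (nat, 'a :: field) free_algebra set)"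
proof
  assume sub: "ideal_prod ring_of_type_algebra (T_ideal m) (T_ideal n)
    \<subseteq> (T_ideal (m + n - 1) :: (nat, 'a) free_algebra set)"
  \<comment> \<open>All indices of the two blocks \<open>[0..<m]\<close> and
    \<open>[m..<m + n]\<close> except their ends, hence at most \<open>m + n - 4\<close> nonzero
    \<open>f i\<close>.\<close>
  define B where "B = {1..<m - 1} \<union> {m + 1..<m + n - 1}"
  have B: "finite B"
    by (simp add: B_def)
  obtain x e y f :: "nat \<Rightarrow> (bool state, 'a) linear_op" where "exterior_pair x e y f"
    and off': "\<forall>i. i \<notin> B \<longrightarrow> y i = 1 \<and> f i = 0"
    and nonzero: "\<forall>v w. distinct v \<longrightarrow> set v \<subseteq> {..<m + n} \<longrightarrow> distinct w \<longrightarrow> set w \<subseteq> B \<longrightarrow>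
      prod_list (map e v) * prod_list (map f w) \<noteq> 0"
    by (rule exists_exterior_pair[OF finite_lessThan[of "m + n"] B])
  have off: "y i = 1" "f i = 0" if "i \<notin> B" for i
    using off' that by auto
  interpret exterior_pair x e y f
    by fact
  interpret nat_exterior_pair x e y f ..
  let ?z = "\<lambda>i. x i * y i"
  let ?var = "\<lambda>i. Poly_Mapping.single (Word [i]) 1 :: (nat, 'a) free_algebra"
  let ?C = "left_normed_commutator (map ?var [0..<m])"
  let ?D = "left_normed_commutator (map ?var [m..<m + n])"
  have var: "eval_free ?z (?var i) = ?z i" for i
    by (simp add: eval_free_single scalar_op_simps)
  have span: "eval_free ?z p \<in> add_span center_words" for p
    unfolding eval_free_def prod_list_letters
  proof (intro add_span_sum add_span_base)
    fix w
    show "scalar_op (Poly_Mapping.lookup p w) * (X.word (letters w) * Y.word (letters w)) \<in> center_words"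
      unfolding center_words_def using scalar_op_commutes by blast
  qed
  have "?C \<in> T_ideal m" "?D \<in> T_ideal n"
    by (simp_all add: left_normed_commutator_in_T_ideal)
  from ideal_prod.prod[OF this, of ring_of_type_algebra] sub
  have "?C * ?D \<in> T_ideal (m + n - 1)"
    by (auto simp: ring_of_type_algebra_def)
  moreover have "left_normed_commutator (map (eval_free ?z) ps) = 0"
    if "length ps = m + n - 1" for ps
  \<comment> \<open>With \<open>p = m' + n' - 2\<close> the length \<open>2 * p + 3\<close> is
    \<open>m + n - 1\<close>, and \<open>2 * Suc p = m + n - 2\<close> exceeds
    \<open>card B\<close>.\<close>
  proof (rule left_normed_commutator_eq_0[OF B off(2), of _ "m' + n' - 2"])
    have "card B \<le> (m - 2) + (n - 2)"
      unfolding B_def by (rule order_trans[OF card_Un_le]) simp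
    then show "card B < 2 * Suc (m' + n' - 2)"
      using assms by simp
    show "length (map (eval_free ?z) ps) = 2 * (m' + n' - 2) + 3"
      using assms that by simp
  qed (use span in auto)
  ultimately have "eval_free ?z (?C * ?D) = 0"
    using assms by (intro eval_free_T_ideal[of "m + n - 1"]) auto
  moreover have ends: "y 0 = 1" "y (m - 1) = 1" "y m = 1" "y (m + n - 1) = 1"
  proof -
    have "2 \<le> m" "2 \<le> n"
      using assms by simp_all
    then have "0 \<notin> B" "m - 1 \<notin> B" "m \<notin> B" "m + n - 1 \<notin> B"
      by (auto simp: B_def)
    then show "y 0 = 1" "y (m - 1) = 1" "y m = 1" "y (m + n - 1) = 1"
      by (simp_all add: off(1))
  qed
  then have "eval_free ?z ?C = prod_list (map e [0..<m]) * prod_list (map f [1..<m - 1])"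
    using left_normed_commutator_upt[of m' 0] assms ends
    by (simp add: eval_free_left_normed_commutator comp_def var)
  moreover have "eval_free ?z ?D
      = prod_list (map e [m..<m + n]) * prod_list (map f [m + 1..<m + n - 1])"
    using left_normed_commutator_upt[of n' m] assms ends
    by (simp add: eval_free_left_normed_commutator comp_def var)
  \<comment> \<open>The two blocks are disjoint, so no letter \<open>e i\<close> or
    \<open>f i\<close> occurs twice in the product of the two commutators.\<close>
  ultimately have "prod_list (map e ([0..<m] @ [m..<m + n]))
      * prod_list (map f ([1..<m - 1] @ [m + 1..<m + n - 1])) = 0"
    by (simp add: eval_free_mult mult.assoc prod_f_prod_e[THEN commute_left])
  then show False
    using nonzero[rule_format, of "[0..<m] @ [m..<m + n]" "[1..<m - 1] @ [m + 1..<m + n - 1]"]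
    by (simp add: B_def ivl_disj_int subset_iff)
qed

end
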